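(* Let $N\ge2$ and let $p,q$ be strictly positive probability mass vectors of size $N$. Then $$\Delta(p\|q)+\Delta(q\|p)=\sum_{i=1}^N(p_i-q_i)[\log p_i-\log q_i]=D(p\|q)+D(q\|p)=\mathscr{D}(p,q),$$ and $$\Delta^c(p\|q)+\Delta^c(q\|p)=\sum_{i=1}^N(q_i-p_i)[\log(1-p_i)-\log(1-q_i)]=D^c(p\|q)+D^c(q\|p)=\mathscr{D}^c(p,q).$$
   Context: For strictly positive probability mass vectors $p=(p_1,\dots,p_N)$ and $q=(q_1,\dots,q_N)$: $\Delta(p\|q)=\sum_i(p_i-q_i)\log p_i$; $\Delta^c(p\|q)=\sum_i\big((1-p_i)-(1-q_i)\big)\log(1-p_i)=\sum_i(q_i-p_i)\log(1-p_i)$; $D(p\|q)=\sum_i p_i\log(p_i/q_i)$; $D^c(p\|q)=\sum_i(1-p_i)\log\frac{1-p_i}{1-q_i}$; the functions with arguments $(q\|p)$ are obtained by exchanging $p$ and $q$. Symmetric divergences: $\mathscr{D}(p,q)=D(p\|q)+D(q\|p)$ and $\mathscr{D}^c(p,q)=D^c(p\|q)+D^c(q\|p)$. $\log$ is the natural logarithm. *)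

theory Defs
  imports "HOL-Analysis.Analysis"
begin

text \<open>Probability mass vectors of size \<open>N\<close> are elements of \<open>real ^ 'n\<close> with
  \<open>N = CARD('n)\<close>. A vector need not be positive here, so the functionals below are
  total; they have their intended meaning on strictly positive mass vectors with
  \<open>N \<ge> 2\<close>, where every \<open>p $ i\<close> lies strictly between 0 and 1.\<close>

definition pos_prob_vec :: "real ^ 'n \<Rightarrow> bool" where
  "pos_prob_vec p \<longleftrightarrow> (\<forall>i. 0 < p $ i) \<and> (\<Sum>i\<in>UNIV. p $ i) = 1"

definition Delta :: "real ^ 'n \<Rightarrow> real ^ 'n \<Rightarrow> real" where
  "Delta p q = (\<Sum>i\<in>UNIV. (p $ i - q $ i) * ln (p $ i))"

definition Delta_c :: "real ^ 'n \<Rightarrow> real ^ 'n \<Rightarrow> real" where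
  "Delta_c p q = (\<Sum>i\<in>UNIV. ((1 - p $ i) - (1 - q $ i)) * ln (1 - p $ i))"

definition KL_div :: "real ^ 'n \<Rightarrow> real ^ 'n \<Rightarrow> real" where
  "KL_div p q = (\<Sum>i\<in>UNIV. p $ i * ln (p $ i / q $ i))"

definition KL_div_c :: "real ^ 'n \<Rightarrow> real ^ 'n \<Rightarrow> real" where
  "KL_div_c p q = (\<Sum>i\<in>UNIV. (1 - p $ i) * ln ((1 - p $ i) / (1 - q $ i)))"

definition sym_div :: "real ^ 'n \<Rightarrow> real ^ 'n \<Rightarrow> real" where
  "sym_div p q = KL_div p q + KL_div q p"

definition sym_div_c :: "real ^ 'n \<Rightarrow> real ^ 'n \<Rightarrow> real" where
  "sym_div_c p q = KL_div_c p q + KL_div_c q p"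

end

theory Submission
  imports Defs
begin

text \<open>
  Both chains are the same computation, carried out once for the masses \<open>p $ i\<close>, \<open>q $ i\<close>
  and once for their complements \<open>1 - p $ i\<close>, \<open>1 - q $ i\<close>. Exchanging the two arguments
  of \<open>Delta\<close> flips the sign of the weight \<open>x - y\<close>, so symmetrising replaces \<open>ln x\<close>
  by \<open>ln x - ln y\<close>. Exchanging the arguments of the divergence flips the sign of
  \<open>ln (x / y) = ln x - ln y\<close>, so symmetrising replaces the weight \<open>x\<close> by \<open>x - y\<close>.
  Both results are the sum of the \<open>(x - y) * (ln x - ln y)\<close>.

  Splitting the logarithm of a quotient requires positive arguments. For the complements this is
  where \<open>N \<ge> 2\<close> enters: a second coordinate of positive mass forces each \<open>p $ i\<close>
  strictly below 1.
\<close>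

lemma pos_prob_vec_less_1:
  fixes p :: "real ^ 'n"
  assumes "CARD('n) \<ge> 2" and "pos_prob_vec p"
  shows "p $ i < 1"
proof -
  have pos: "\<And>k. 0 < p $ k" and total: "(\<Sum>k\<in>UNIV. p $ k) = 1"
    using assms(2) by (auto simp: pos_prob_vec_def)
  have "UNIV - {i} \<noteq> {}"
  proof
    assume "UNIV - {i} = {}"
    then have "(UNIV :: 'n set) = {i}" by auto
    then have "CARD('n) = card {i}" by (rule arg_cong)
    then show False using assms(1) by simp
  qed
  then have "0 < (\<Sum>k\<in>UNIV - {i}. p $ k)"
    using pos by (intro sum_pos) auto
  moreover have "(\<Sum>k\<in>UNIV. p $ k) = p $ i + (\<Sum>k\<in>UNIV - {i}. p $ k)"
    by (rule sum.remove) auto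
  ultimately show ?thesis using total by linarith
qed

lemma sum_weighted_ln_symmetrised:
  fixes x y :: "'a \<Rightarrow> real"
  shows "(\<Sum>i\<in>A. (x i - y i) * ln (x i)) + (\<Sum>i\<in>A. (y i - x i) * ln (y i))
    = (\<Sum>i\<in>A. (x i - y i) * (ln (x i) - ln (y i)))"
  by (simp add: sum.distrib[symmetric] algebra_simps)

text \<open>Stated for arbitrary positive weights so as to serve for the masses, of sum 1, and for
  their complements, of sum \<open>N - 1\<close>.\<close>

lemma sum_relative_entropy_symmetrised:
  fixes x y :: "'a \<Rightarrow> real"
  assumes "\<And>i. i \<in> A \<Longrightarrow> 0 < x i" and "\<And>i. i \<in> A \<Longrightarrow> 0 < y i"
  shows "(\<Sum>i\<in>A. x i * ln (x i / y i)) + (\<Sum>i\<in>A. y i * ln (y i / x i))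
    = (\<Sum>i\<in>A. (x i - y i) * (ln (x i) - ln (y i)))"
  unfolding sum.distrib[symmetric]
proof (rule sum.cong)
  fix i assume "i \<in> A"
  then have "0 < x i" "0 < y i" using assms by auto
  then show "x i * ln (x i / y i) + y i * ln (y i / x i) = (x i - y i) * (ln (x i) - ln (y i))"
    by (simp add: ln_div algebra_simps)
qed simp

theorem corollary1:
  fixes p q :: "real ^ 'n"
  assumes "CARD('n) \<ge> 2"
    and "pos_prob_vec p"
    and "pos_prob_vec q"
  shows "(Delta p q + Delta q p = (\<Sum>i\<in>UNIV. (p $ i - q $ i) * (ln (p $ i) - ln (q $ i)))
        \<and> (\<Sum>i\<in>UNIV. (p $ i - q $ i) * (ln (p $ i) - ln (q $ i))) = KL_div p q + KL_div q p
        \<and> KL_div p q + KL_div q p = sym_div p q)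
    \<and> (Delta_c p q + Delta_c q p
          = (\<Sum>i\<in>UNIV. (q $ i - p $ i) * (ln (1 - p $ i) - ln (1 - q $ i)))
        \<and> (\<Sum>i\<in>UNIV. (q $ i - p $ i) * (ln (1 - p $ i) - ln (1 - q $ i)))
          = KL_div_c p q + KL_div_c q p
        \<and> KL_div_c p q + KL_div_c q p = sym_div_c p q)"
proof -
  have pos: "\<And>i. 0 < p $ i" "\<And>i. 0 < q $ i"
    using assms(2,3) by (auto simp: pos_prob_vec_def)
  have pos_c: "\<And>i. 0 < 1 - p $ i" "\<And>i. 0 < 1 - q $ i"
    using pos_prob_vec_less_1[OF assms(1)] assms(2,3) by simp_all
  have Delta: "Delta p q + Delta q p = (\<Sum>i\<in>UNIV. (p $ i - q $ i) * (ln (p $ i) - ln (q $ i)))"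
    unfolding Delta_def by (rule sum_weighted_ln_symmetrised)
  have KL: "KL_div p q + KL_div q p = (\<Sum>i\<in>UNIV. (p $ i - q $ i) * (ln (p $ i) - ln (q $ i)))"
    unfolding KL_div_def using pos by (rule sum_relative_entropy_symmetrised)
  have weight_c: "(1 - p $ i) - (1 - q $ i) = q $ i - p $ i" for i
    by simp
  have Delta_c: "Delta_c p q + Delta_c q p
      = (\<Sum>i\<in>UNIV. (q $ i - p $ i) * (ln (1 - p $ i) - ln (1 - q $ i)))"
    unfolding Delta_c_def weight_c[symmetric] by (rule sum_weighted_ln_symmetrised)
  have KL_c: "KL_div_c p q + KL_div_c q p
      = (\<Sum>i\<in>UNIV. (q $ i - p $ i) * (ln (1 - p $ i) - ln (1 - q $ i)))"
    unfolding KL_div_c_def weight_c[symmetric]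
    using pos_c by (rule sum_relative_entropy_symmetrised)
  show ?thesis
    using Delta KL Delta_c KL_c by (simp add: sym_div_def sym_div_c_def)
qed

end
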